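(* Let $F\colon\mathbb R^n\times\mathbb R_+\rightrightarrows\mathbb R^n$ be a set-valued map, and let $(x_k)$ satisfy $x_{k+1}\in x_k+F(x_k,\alpha_k)+e_k$ for all $k\in\mathbb N$, where $e_k\in\mathbb R^n$, $\alpha_k>0$, $\alpha_k\to\underline\alpha\in\mathbb R_+$, $\sum_{k=0}^\infty\alpha_k=\infty$, and $$\lim_{N\to\infty}\frac{\sum_{k=0}^Ne_k}{\sum_{k=0}^N\alpha_k}=0.$$ If $x_k\to x^*$ and the set-valued map $(y,\alpha)\mapsto F(y,\alpha)/\alpha$ (with domain $\mathbb R^n\times(0,\infty)$) is locally bounded near $(x^*,\underline\alpha)$, then $$0\in\operatorname{co}\limsup_{\substack{(y,\alpha)\to(x^*,\underline\alpha)\\\alpha>0}}\frac1\alpha F(y,\alpha).$$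
   Context: $\mathbb R_+=[0,\infty)$; $\operatorname{co}$ denotes the convex hull. The outer limit $\limsup_{(y,\alpha)\to(x^*,\underline\alpha),\,\alpha>0}\frac1\alpha F(y,\alpha)$ is the set of all $v\in\mathbb R^n$ for which there are sequences $y_j\to x^*$, $\alpha_j>0$ with $\alpha_j\to\underline\alpha$, and $v_j\in F(y_j,\alpha_j)/\alpha_j$ with $v_j\to v$. Local boundedness near $(x^*,\underline\alpha)$ is relative to the domain $\mathbb R^n\times(0,\infty)$: there is a neighborhood $W$ of $(x^*,\underline\alpha)$ such that $\bigcup_{(y,\alpha)\in W,\ \alpha>0}F(y,\alpha)/\alpha$ is bounded. *)

theory Defs
  imports "HOL-Analysis.Analysis"
begin

text \<open>A set-valued map with domain \<open>D\<close> is a function into sets of which only the values on \<open>D\<close> are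
  used. The base point \<open>z\<close> need not belong to \<open>D\<close>, and sequences may take the value \<open>z\<close> if it does.\<close>

definition outer_limit ::
    "'a::topological_space set \<Rightarrow> ('a \<Rightarrow> 'b::topological_space set) \<Rightarrow> 'a \<Rightarrow> 'b set" where
  "outer_limit D G z =
    {v. \<exists>u w. (\<forall>j::nat. u j \<in> D) \<and> u \<longlonglongrightarrow> z \<and> (\<forall>j. w j \<in> G (u j)) \<and> w \<longlonglongrightarrow> v}"

definition locally_bounded_near ::
    "'a::topological_space set \<Rightarrow> ('a \<Rightarrow> 'b::metric_space set) \<Rightarrow> 'a \<Rightarrow> bool" where
  "locally_bounded_near D G z \<longleftrightarrow> (\<exists>W. open W \<and> z \<in> W \<and> bounded (\<Union>p\<in>W \<inter> D. G p))"

definition step_quotient ::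
    "('a::real_vector \<times> real \<Rightarrow> 'a set) \<Rightarrow> 'a \<times> real \<Rightarrow> 'a set" where
  "step_quotient F = (\<lambda>(y, \<alpha>). (\<lambda>v. v /\<^sub>R \<alpha>) ` F (y, \<alpha>))"

end

theory Submission
  imports Defs
begin

text \<open>Put \<open>w k = (x (Suc k) - x k - e k) / \<alpha> k\<close>, an element of \<open>F (x k, \<alpha> k) / \<alpha> k\<close>. By telescoping,
  the averages of \<open>w\<close> with weights \<open>\<alpha>\<close> tend to \<open>0\<close>. A limit of such averages
  of a bounded sequence lies in the convex hull of its cluster points, because a hyperplane
  strictly separating it from this compact set would eventually separate it from the sequence and
  hence, the total weight being infinite, from the averages. Every cluster point of \<open>w\<close> belongs to
  the outer limit.\<close>

text \<open>Encoded through closures of tails rather than through subsequences: closedness is then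
  immediate, and subsequences are extracted only when the outer limit is reached.\<close>

definition cluster_points :: "(nat \<Rightarrow> 'a::topological_space) \<Rightarrow> 'a set" where
  "cluster_points w = (\<Inter>n. closure (w ` {n..}))"

lemma cluster_points_subset_closure_range: "cluster_points w \<subseteq> closure (range w)"
  unfolding cluster_points_def by (rule INF_lower2[of 0]) (simp_all add: closure_mono)

lemma compact_cluster_points:
  fixes w :: "nat \<Rightarrow> 'a::heine_borel"
  assumes "bounded (range w)"
  shows "compact (cluster_points w)"
  unfolding compact_eq_bounded_closed
proof
  show "bounded (cluster_points w)"
    using assms cluster_points_subset_closure_range bounded_closure bounded_subset by blast
  show "closed (cluster_points w)"
    unfolding cluster_points_def by (intro closed_INT) auto
qed

text \<open>Bolzano-Weierstrass along the infinitely many indices with \<open>w k \<in> H\<close>: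
  the closures \<open>T n\<close> of the corresponding tails are nonempty, compact and nested, so
  they share a point.\<close>

lemma cluster_points_meets_closed:
  fixes w :: "nat \<Rightarrow> 'a::heine_borel"
  assumes bdd: "bounded (range w)" and "closed H" and freq: "\<exists>\<^sub>F k in sequentially. w k \<in> H"
  shows "cluster_points w \<inter> H \<noteq> {}"
proof -
  define T where "T n = closure (w ` {k. n \<le> k \<and> w k \<in> H})" for n
  have "\<Inter>(range T) \<noteq> {}"
  proof (rule compact_nest)
    fix n
    have "bounded (w ` {k. n \<le> k \<and> w k \<in> H})"
      by (rule bounded_subset[OF bdd]) auto
    then show "compact (T n)"
      by (simp add: T_def compact_closure)
    show "T n \<noteq> {}"
      using freq by (force simp: T_def frequently_sequentially)
  next
    fix m n :: nat
    assume "m \<le> n"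
    then show "T n \<subseteq> T m"
      unfolding T_def by (intro closure_mono) auto
  qed
  then obtain v where v: "\<And>n. v \<in> T n"
    by auto
  have "T n \<subseteq> closure (w ` {n..})" for n
    unfolding T_def by (intro closure_mono) auto
  with v have "v \<in> cluster_points w"
    unfolding cluster_points_def by (intro INT_I) (rule subsetD)
  moreover have "T 0 \<subseteq> H"
    unfolding T_def using \<open>closed H\<close> by (intro closure_minimal) auto
  with v have "v \<in> H"
    by (rule subsetD[rotated])
  ultimately show ?thesis
    by blast
qed

lemma weighted_average_limit_in_hull:
  fixes w :: "nat \<Rightarrow> 'a::euclidean_space" and \<alpha> :: "nat \<Rightarrow> real"
  assumes bdd: "bounded (range w)"
    and nonneg: "\<And>k. \<alpha> k \<ge> 0"
    and div: "filterlim (\<lambda>N. \<Sum>k\<le>N. \<alpha> k) at_top sequentially"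
    and lim: "(\<lambda>N. (\<Sum>k\<le>N. \<alpha> k *\<^sub>R w k) /\<^sub>R (\<Sum>k\<le>N. \<alpha> k)) \<longlonglongrightarrow> m"
  shows "m \<in> convex hull (cluster_points w)"
proof (rule ccontr)
  assume "m \<notin> convex hull (cluster_points w)"
  \<comment> \<open>In finite dimension the convex hull of a compact set is compact, which gives the
    closedness needed for strict separation.\<close>
  moreover have "closed (convex hull (cluster_points w))"
    by (simp add: bdd compact_cluster_points compact_convex_hull compact_imp_closed)
  ultimately obtain a b where am: "a \<bullet> m < b"
    and sep: "\<And>v. v \<in> convex hull (cluster_points w) \<Longrightarrow> b < a \<bullet> v"
    using separating_hyperplane_closed_point[OF convex_convex_hull] by metis
  \<comment> \<open>Infinitely many visits to this closed half-space would produce a cluster point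
    in it, on the wrong side of the hyperplane.\<close>
  have "\<not> (\<exists>\<^sub>F k in sequentially. w k \<in> {v. a \<bullet> v \<le> b})"
  proof
    assume "\<exists>\<^sub>F k in sequentially. w k \<in> {v. a \<bullet> v \<le> b}"
    then have "cluster_points w \<inter> {v. a \<bullet> v \<le> b} \<noteq> {}"
      by (intro cluster_points_meets_closed bdd closed_halfspace_le)
    then show False
      using sep hull_subset by fastforce
  qed
  then obtain K where K: "\<And>k. k \<ge> K \<Longrightarrow> a \<bullet> w k \<ge> b"
    unfolding not_frequently eventually_sequentially by fastforce
  define A where "A N = (\<Sum>k\<le>N. \<alpha> k)" for N
  \<comment> \<open>The terms before \<open>K\<close> may be negative, but their sum
    \<open>C\<close> does not depend on \<open>N\<close>; all later terms are nonnegative.\<close>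
  define C where "C = (\<Sum>k<K. \<alpha> k * (a \<bullet> w k - b))"
  have A: "filterlim A at_top sequentially"
    using div by (simp add: A_def[abs_def])
  have lower: "C \<le> (\<Sum>k\<le>N. \<alpha> k * (a \<bullet> w k - b))" if "N \<ge> K" for N
    unfolding C_def using that K nonneg by (intro sum_mono2) auto
  \<comment> \<open>The bound is only eventual: besides \<open>N \<ge> K\<close>, dividing by
    \<open>A N\<close> requires \<open>A N > 0\<close>, which holds once the diverging sums exceed
    0.\<close>
  have "\<forall>\<^sub>F N in sequentially.
      b + C / A N \<le> a \<bullet> ((\<Sum>k\<le>N. \<alpha> k *\<^sub>R w k) /\<^sub>R (\<Sum>k\<le>N. \<alpha> k))"
    using eventually_ge_at_top[of K] A[unfolded filterlim_at_top_dense, rule_format, of 0]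
  proof eventually_elim
    case (elim N)
    have "b * A N + C \<le> a \<bullet> (\<Sum>k\<le>N. \<alpha> k *\<^sub>R w k)"
      using lower[OF elim(1)]
      by (simp add: A_def inner_sum_right right_diff_distrib sum_subtractf sum_distrib_left mult.commute)
    then have "b + C / A N \<le> (a \<bullet> (\<Sum>k\<le>N. \<alpha> k *\<^sub>R w k)) / A N"
      using elim(2) by (simp add: pos_le_divide_eq distrib_right)
    then show ?case
      by (simp add: A_def divide_inverse_commute)
  qed
  moreover have "(\<lambda>N. b + C / A N) \<longlonglongrightarrow> b + 0"
    by (intro tendsto_intros tendsto_divide_0[OF tendsto_const] filterlim_at_top_imp_at_infinity A)
  ultimately have "b + 0 \<le> a \<bullet> m"
    by (intro tendsto_le[OF _ tendsto_inner[OF tendsto_const lim]]) auto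
  with am show False by simp
qed

lemma cluster_points_subset_outer_limit:
  fixes w :: "nat \<Rightarrow> 'b::metric_space"
  assumes "\<And>k. u k \<in> D" and u: "u \<longlonglongrightarrow> z" and "\<And>k. w k \<in> G (u k)"
  shows "cluster_points w \<subseteq> outer_limit D G z"
proof
  fix v
  assume v: "v \<in> cluster_points w"
  have "\<exists>k\<ge>j. dist (w k) v < inverse (real (Suc j))" for j
  proof -
    have "v \<in> closure (w ` {j..})"
      using v by (simp add: cluster_points_def)
    moreover have "0 < inverse (real (Suc j))" by simp
    ultimately show ?thesis
      unfolding closure_approachable by (metis atLeast_iff imageE)
  qed
  then obtain r where r: "\<And>j. j \<le> r j" "\<And>j. dist (w (r j)) v < inverse (real (Suc j))"
    by metis
  \<comment> \<open>The indices \<open>r j\<close> need not increase strictly;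
    \<open>j \<le> r j\<close> already makes them diverge.\<close>
  have "filterlim r sequentially sequentially"
    by (rule filterlim_at_top_mono[OF filterlim_ident]) (simp add: r)
  then have "(\<lambda>j. u (r j)) \<longlonglongrightarrow> z"
    by (rule filterlim_compose[OF u])
  moreover have "(\<lambda>j. w (r j)) \<longlonglongrightarrow> v"
    by (rule metric_tendsto_imp_tendsto[OF LIMSEQ_inverse_real_of_nat])
      (use r(2) in \<open>simp add: dist_real_def less_imp_le\<close>)
  ultimately show "v \<in> outer_limit D G z"
    unfolding outer_limit_def using assms(1,3)
    by (intro CollectI exI[of _ "\<lambda>j. u (r j)"] exI[of _ "\<lambda>j. w (r j)"] conjI allI)
qed

text \<open>The neighborhood controls a tail of \<open>w\<close>; the finitely many earlier values
  form a bounded set anyway.\<close>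

lemma locally_bounded_near_imp_bounded_range:
  assumes "locally_bounded_near D G z" and "\<And>k. u k \<in> D" and "u \<longlonglongrightarrow> z" and "\<And>k. w k \<in> G (u k)"
  shows "bounded (range w)"
proof -
  obtain W where "open W" "z \<in> W" and bdd: "bounded (\<Union>p\<in>W \<inter> D. G p)"
    using assms(1) unfolding locally_bounded_near_def by blast
  then obtain K where "\<And>k. k \<ge> K \<Longrightarrow> u k \<in> W"
    using topological_tendstoD[OF assms(3)] by (auto simp: eventually_sequentially)
  then have "w ` {K..} \<subseteq> (\<Union>p\<in>W \<inter> D. G p)"
    using assms(2,4) by blast
  then have "bounded (w ` {..<K} \<union> w ` {K..})"
    using bounded_subset[OF bdd] by (simp add: finite_imp_bounded)
  moreover have "range w = w ` {..<K} \<union> w ` {K..}"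
    unfolding image_Un[symmetric] by (intro arg_cong[where f = "image w"]) auto
  ultimately show ?thesis by simp
qed

theorem proposition2p5:
  fixes F :: "(real ^ 'n) \<times> real \<Rightarrow> (real ^ 'n) set"
    and x e :: "nat \<Rightarrow> real ^ 'n"
    and \<alpha> :: "nat \<Rightarrow> real"
    and xstar :: "real ^ 'n"
    and \<alpha>_lim :: real
  assumes "\<And>k. x (Suc k) \<in> (\<lambda>v. x k + v + e k) ` F (x k, \<alpha> k)"
    and "\<And>k. \<alpha> k > 0"
    and "\<alpha> \<longlonglongrightarrow> \<alpha>_lim"
    and "\<alpha>_lim \<ge> 0"
    and "filterlim (\<lambda>N. \<Sum>k\<le>N. \<alpha> k) at_top sequentially"
    and "(\<lambda>N. (\<Sum>k\<le>N. e k) /\<^sub>R (\<Sum>k\<le>N. \<alpha> k)) \<longlonglongrightarrow> 0"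
    and "x \<longlonglongrightarrow> xstar"
    and "locally_bounded_near (UNIV \<times> {0<..}) (step_quotient F) (xstar, \<alpha>_lim)"
  shows "0 \<in> convex hull (outer_limit (UNIV \<times> {0<..}) (step_quotient F) (xstar, \<alpha>_lim))"
proof -
  define w where "w k = (x (Suc k) - x k - e k) /\<^sub>R \<alpha> k" for k
  define A where "A N = (\<Sum>k\<le>N. \<alpha> k)" for N
  have D: "(x k, \<alpha> k) \<in> UNIV \<times> {0<..}" for k
    using assms(2) by simp
  have w: "w k \<in> step_quotient F (x k, \<alpha> k)" for k
    using assms(1)[of k] by (auto simp: w_def step_quotient_def)
  have lim: "(\<lambda>k. (x k, \<alpha> k)) \<longlonglongrightarrow> (xstar, \<alpha>_lim)"
    by (intro tendsto_Pair assms(3,7))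
  have bdd: "bounded (range w)"
    using assms(8) D lim w by (rule locally_bounded_near_imp_bounded_range)
  \<comment> \<open>The weight \<open>\<alpha> k\<close> cancels the division in \<open>w k\<close>,
    so the increments of \<open>x\<close> telescope.\<close>
  have sum_w: "(\<Sum>k\<le>N. \<alpha> k *\<^sub>R w k) = x (Suc N) - x 0 - (\<Sum>k\<le>N. e k)" for N
  proof -
    have "\<alpha> k *\<^sub>R w k = x (Suc k) - x k - e k" for k
      using assms(2)[of k] by (simp add: w_def)
    then show ?thesis
      by (induction N) auto
  qed
  have "(\<lambda>N. inverse (A N)) \<longlonglongrightarrow> 0"
    using assms(5) by (simp add: A_def[abs_def] tendsto_inverse_0_at_top)
  \<comment> \<open>The telescoped numerator converges to \<open>xstar - x 0\<close>, so division by
    the diverging \<open>A N\<close> sends the quotient to 0.\<close>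
  then have "(\<lambda>N. (x (Suc N) - x 0) /\<^sub>R A N) \<longlonglongrightarrow> 0 *\<^sub>R (xstar - x 0)"
    by (intro tendsto_intros LIMSEQ_Suc assms(7))
  then have "(\<lambda>N. (x (Suc N) - x 0) /\<^sub>R A N - (\<Sum>k\<le>N. e k) /\<^sub>R A N) \<longlonglongrightarrow> 0 *\<^sub>R (xstar - x 0) - 0"
    using assms(6) unfolding A_def by (rule tendsto_diff)
  then have "(\<lambda>N. (\<Sum>k\<le>N. \<alpha> k *\<^sub>R w k) /\<^sub>R (\<Sum>k\<le>N. \<alpha> k)) \<longlonglongrightarrow> 0"
    by (simp add: sum_w A_def scaleR_diff_right)
  then have "0 \<in> convex hull (cluster_points w)"
    using assms(2) by (intro weighted_average_limit_in_hull[OF bdd _ assms(5)] less_imp_le)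
  moreover have "cluster_points w \<subseteq> outer_limit (UNIV \<times> {0<..}) (step_quotient F) (xstar, \<alpha>_lim)"
    using D lim w by (rule cluster_points_subset_outer_limit)
  ultimately show ?thesis
    using hull_mono by blast
qed

end
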